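(* Let $\mathcal{I}'$ be the set of item copies of an instance of the Colored Bin Packing Problem with bin capacity $L$ and $Q\ge 2$ colors, and let $S \subseteq \mathcal{I}'$ satisfy $\sum_{u \in S} l_u \leq L$. The following are equivalent: 1. $S$ admits a color-alternating permutation; 2. $|S_{q^*}| \leq \lceil |S|/2\rceil$, where $q^*$ is the critical color of $S$; 3. $\delta^S \leq 1$, where $\delta^S$ is the color discrepancy of $S$.
   Context: Notation: $[k]=\{1,\dots,k\}$. An instance of the Colored Bin Packing Problem (CBPP) consists of an integer bin capacity $L>0$, an integer number of colors $Q\ge 2$, and a set $\mathcal{I}=[m]$ of items, each item $u$ having an integer length $l_u>0$, an integer demand $d_u>0$ and a color $c_u\in[Q]$; all (length, color) pairs are distinct in $\mathcal{I}$. The set $\mathcal{I}'$ consists of $d_u$ copies of each item $u\in\mathcal{I}$, each copy having the length and color of $u$. For a finite $S\subseteq\mathcal{I}'$ and $q\in[Q]$, let $S_q=\{u\in S: c_u=q\}$. A color-alternating permutation of $S$ is an ordering of all the elements of $S$ in which no two consecutive elements have the same color. For $q\in[Q]$ let $\delta^S_q=\sum_{u\in S}s_{q,u}$, where $s_{q,u}=1$ if $c_u=q$ and $s_{q,u}=-1$ otherwise. The color discrepancy of $S$ is $\delta^S=\max_{q\in[Q]}\delta^S_q$, and the critical color is $q^*=\arg\max_{q\in[Q]}\delta^S_q$ (ties broken arbitrarily). *)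

theory Defs
  imports Complex_Main "HOL-Combinatorics.Multiset_Permutations"
begin

record cbpp =
  capacity :: nat
  num_colors :: nat
  num_items :: nat
  item_length :: "nat \<Rightarrow> nat"
  item_demand :: "nat \<Rightarrow> nat"
  item_color :: "nat \<Rightarrow> nat"

definition items :: "cbpp \<Rightarrow> nat set" where
  "items P = {1..num_items P}"

definition colors :: "cbpp \<Rightarrow> nat set" where
  "colors P = {1..num_colors P}"

definition cbpp_instance :: "cbpp \<Rightarrow> bool" where
  "cbpp_instance P \<longleftrightarrow>
     capacity P > 0 \<and> num_colors P \<ge> 2 \<and>
     (\<forall>u\<in>items P. item_length P u > 0 \<and> item_demand P u > 0 \<and> item_color P u \<in> colors P) \<and>
     inj_on (\<lambda>u. (item_length P u, item_color P u)) (items P)"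

text \<open>The pair \<open>(u, k)\<close> with \<open>1 \<le> k \<le> item_demand P u\<close> stands for the \<open>k\<close>-th copy of the item \<open>u\<close>.\<close>

type_synonym item_copy = "nat \<times> nat"

definition item_copies :: "cbpp \<Rightarrow> item_copy set" where
  "item_copies P = (SIGMA u : items P. {1..item_demand P u})"

definition copy_length :: "cbpp \<Rightarrow> item_copy \<Rightarrow> nat" where
  "copy_length P x = item_length P (fst x)"

definition copy_color :: "cbpp \<Rightarrow> item_copy \<Rightarrow> nat" where
  "copy_color P x = item_color P (fst x)"

definition color_class :: "cbpp \<Rightarrow> item_copy set \<Rightarrow> nat \<Rightarrow> item_copy set" where
  "color_class P S q = {x \<in> S. copy_color P x = q}"

definition color_alternating_permutation :: "cbpp \<Rightarrow> item_copy set \<Rightarrow> item_copy list \<Rightarrow> bool" where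
  "color_alternating_permutation P S xs \<longleftrightarrow>
     xs \<in> permutations_of_set S \<and>
     successively (\<lambda>x y. copy_color P x \<noteq> copy_color P y) xs"

definition discrepancy_of_color :: "cbpp \<Rightarrow> item_copy set \<Rightarrow> nat \<Rightarrow> int" where
  "discrepancy_of_color P S q = (\<Sum>x\<in>S. if copy_color P x = q then 1 else - 1)"

definition color_discrepancy :: "cbpp \<Rightarrow> item_copy set \<Rightarrow> int" where
  "color_discrepancy P S = Max (discrepancy_of_color P S ` colors P)"

text \<open>A predicate rather than a function, since the maximum may be attained by several colors.\<close>

definition critical_color :: "cbpp \<Rightarrow> item_copy set \<Rightarrow> nat \<Rightarrow> bool" where
  "critical_color P S q \<longleftrightarrow> is_arg_max (discrepancy_of_color P S) (\<lambda>r. r \<in> colors P) q"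

end

theory Submission
  imports Defs
begin

text \<open>
  Since \<open>\<delta>\<^sub>q = 2 |S\<^sub>q| - |S|\<close>, conditions 2 and 3 both say that \<open>2 |S\<^sub>q| \<le> |S| + 1\<close> for all colors
  \<open>q\<close>. This is necessary because among two consecutive elements at most one has color \<open>q\<close>. For
  sufficiency, build the permutation greedily, remembering the color \<open>c\<close> that must not come next,
  with the invariant \<open>2 |S\<^sub>q| \<le> |S| + 1\<close> for all \<open>q\<close> and \<open>2 |S\<^sub>c| \<le> |S|\<close>. If \<open>2 |S\<^sub>q| = |S| + 1\<close> for
  some \<open>q\<close>, then \<open>q\<close> is unique and different from \<open>c\<close>, and an element of color \<open>q\<close> comes next;
  otherwise any element of color different from \<open>c\<close> will do.
\<close>

lemma successively_neq_imp_filter_le: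
  assumes "successively (\<lambda>x y. f x \<noteq> f y) xs"
  shows "2 * length (filter (\<lambda>x. f x = q) xs) \<le> length xs + 1"
  \<comment> \<open>\<open>induct_list012\<close> strips two entries at a time, at most one of them
    of color \<open>q\<close>; the \<open>+ 1\<close> pays for a single leftover entry.\<close>
  using assms by (induction xs rule: induct_list012) (auto simp: successively_Cons)

text \<open>Once \<open>x\<close> is removed, only its own class shrinks, so every other color must
  already satisfy the bound without \<open>+ 1\<close>.\<close>

lemma obtain_next_element:
  fixes f :: "'a \<Rightarrow> 'b"
  assumes fin: "finite S" and "S \<noteq> {}"
    and le: "\<And>q. 2 * card {x \<in> S. f x = q} \<le> card S + 1"
    and c: "2 * card {x \<in> S. f x = c} \<le> card S"
  obtains x where "x \<in> S" "f x \<noteq> c" "\<And>q. q \<noteq> f x \<Longrightarrow> 2 * card {y \<in> S. f y = q} \<le> card S"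
proof (cases "\<exists>q. 2 * card {x \<in> S. f x = q} = card S + 1")
  case True
  then obtain q where q: "2 * card {x \<in> S. f x = q} = card S + 1" by blast
  then have "card {x \<in> S. f x = q} \<noteq> 0" by linarith
  then have "{x \<in> S. f x = q} \<noteq> {}" by (metis card.empty)
  then obtain x where x: "x \<in> S" "f x = q" by blast
  have "2 * card {y \<in> S. f y = r} \<le> card S" if "r \<noteq> q" for r
  proof -
    have "card {y \<in> S. f y = r} + card {y \<in> S. f y = q}
        = card ({y \<in> S. f y = r} \<union> {y \<in> S. f y = q})"
      using fin that by (intro card_Un_disjoint [symmetric]) auto
    also have "\<dots> \<le> card S"
      using fin by (intro card_mono) auto
    finally show ?thesis using q by linarith
  qed
  moreover have "q \<noteq> c" using q c by auto
  ultimately show thesis using x that by auto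
next
  case False
  have "card S \<noteq> 0" using fin \<open>S \<noteq> {}\<close> by simp
  \<comment> \<open>Otherwise \<open>c\<close> would give \<open>2 * card S \<le> card S\<close>,
    impossible for nonempty \<open>S\<close>.\<close>
  with c have "{x \<in> S. f x = c} \<noteq> S" by (metis add_le_same_cancel1 le_zero_eq mult_2)
  then obtain x where "x \<in> S" "f x \<noteq> c" by blast
  moreover have "2 * card {y \<in> S. f y = q} \<le> card S" for q
    using le [of q] False by (metis Suc_eq_plus1 le_SucE)
  ultimately show thesis using that by blast
qed

text \<open>Here \<open>c\<close> is the color of the element placed just before; the condition on
  \<open>hd xs\<close> lets that element be prepended. Since this color changes at each step, the
  induction keeps \<open>c\<close> arbitrary.\<close>

lemma ex_alternating_permutation_avoiding:
  assumes "finite S"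
    and "\<And>q. 2 * card {x \<in> S. f x = q} \<le> card S + 1"
    and "2 * card {x \<in> S. f x = c} \<le> card S"
  shows "\<exists>xs \<in> permutations_of_set S.
           successively (\<lambda>x y. f x \<noteq> f y) xs \<and> (xs = [] \<or> f (hd xs) \<noteq> c)"
  using assms
proof (induction "card S" arbitrary: S c)
  case 0
  then show ?case by simp
next
  case (Suc n)
  have "S \<noteq> {}" using Suc.hyps by auto
  with Suc.prems obtain x where x: "x \<in> S" "f x \<noteq> c"
    and other: "\<And>q. q \<noteq> f x \<Longrightarrow> 2 * card {y \<in> S. f y = q} \<le> card S"
    by (auto intro: obtain_next_element [of S f c])
  define T where "T = S - {x}"
  have T: "finite T" "card S = Suc (card T)" "n = card T"
    using x Suc.prems(1) Suc.hyps(2) by (auto simp: T_def card_Suc_Diff1)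
  have cls: "card {y \<in> S. f y = f x} = Suc (card {y \<in> T. f y = f x})"
  proof -
    have "{y \<in> S. f y = f x} = insert x {y \<in> T. f y = f x}" using x by (auto simp: T_def)
    then show ?thesis using T(1) by (simp add: T_def)
  qed
  \<comment> \<open>Dropping \<open>x\<close> lowers the left side by 2 and \<open>card S\<close> by
    1, so the slack \<open>+ 1\<close> disappears: this is the invariant with \<open>f x\<close> as
    the new forbidden color.\<close>
  have same: "2 * card {y \<in> T. f y = f x} \<le> card T"
    using Suc.prems(2) [of "f x"] T(2) cls by linarith
  have "2 * card {y \<in> T. f y = q} \<le> card T + 1" for q
  proof (cases "q = f x")
    case False
    then have "{y \<in> T. f y = q} = {y \<in> S. f y = q}" by (auto simp: T_def)
    then show ?thesis using other [OF False] T(2) by simp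
  qed (use same in simp)
  from Suc.hyps(1) [OF T(3,1) this same] obtain xs where
    xs: "xs \<in> permutations_of_set T" "successively (\<lambda>x y. f x \<noteq> f y) xs"
      "xs = [] \<or> f (hd xs) \<noteq> f x" by blast
  have "x # xs \<in> permutations_of_set S"
    using xs(1) x(1) by (auto simp: permutations_of_set_def T_def)
  moreover have "successively (\<lambda>x y. f x \<noteq> f y) (x # xs)"
    using xs(2,3) by (auto simp: successively_Cons)
  ultimately show ?case using x(2) by (intro bexI [of _ "x # xs"]) auto
qed

lemma discrepancy_of_color_eq:
  assumes "finite S"
  shows "discrepancy_of_color P S q = 2 * int (card (color_class P S q)) - int (card S)"
proof -
  have "discrepancy_of_color P S q = (\<Sum>x\<in>S. 2 * (if copy_color P x = q then 1 else 0) - 1)"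
    unfolding discrepancy_of_color_def by (intro sum.cong) auto
  also have "\<dots> = 2 * (\<Sum>x\<in>S. if copy_color P x = q then 1 else 0) - int (card S)"
    by (simp add: sum_subtractf sum_distrib_left)
  also have "(\<Sum>x\<in>S. if copy_color P x = q then 1 else 0) = int (card (color_class P S q))"
    using assms by (simp add: color_class_def sum.If_cases Int_def)
  finally show ?thesis .
qed

lemma color_discrepancy_eq:
  assumes "critical_color P S q"
  shows "color_discrepancy P S = discrepancy_of_color P S q"
  using assms unfolding color_discrepancy_def critical_color_def is_arg_max_linorder
  by (intro Max_eqI) (auto simp: colors_def)

text \<open>Discrepancy increases with class size, so its maximizer has the largest class; a number
  outside \<open>colors P\<close> has an empty class.\<close>

lemma card_color_class_le_critical:
  assumes "finite S" "copy_color P ` S \<subseteq> colors P" "critical_color P S qstar"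
  shows "card (color_class P S q) \<le> card (color_class P S qstar)"
proof (cases "q \<in> colors P")
  case True
  then have "discrepancy_of_color P S q \<le> discrepancy_of_color P S qstar"
    using assms(3) by (simp add: critical_color_def is_arg_max_linorder)
  then show ?thesis using assms(1) by (simp add: discrepancy_of_color_eq)
next
  case False
  then have "color_class P S q = {}" using assms(2) by (auto simp: color_class_def)
  then show ?thesis by simp
qed

lemma card_color_class_alternating_le:
  assumes "color_alternating_permutation P S xs"
  shows "2 * card (color_class P S q) \<le> card S + 1"
proof -
  have xs: "set xs = S" "distinct xs" "successively (\<lambda>x y. copy_color P x \<noteq> copy_color P y) xs"
    using assms by (auto simp: color_alternating_permutation_def permutations_of_set_def)
  have "card (color_class P S q) = length (filter (\<lambda>x. copy_color P x = q) xs)"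
    using distinct_card [OF distinct_filter [OF xs(2)]] xs(1) by (simp add: color_class_def)
  then show ?thesis
    using successively_neq_imp_filter_le [OF xs(3), of q] distinct_card [OF xs(2)] xs(1) by simp
qed

theorem theorem1:
  fixes P :: cbpp and S :: "item_copy set" and qstar :: nat
  assumes "cbpp_instance P"
    and "S \<subseteq> item_copies P"
    and "(\<Sum>x\<in>S. copy_length P x) \<le> capacity P"
    and "critical_color P S qstar"
  shows "((\<exists>xs. color_alternating_permutation P S xs) \<longleftrightarrow>
            int (card (color_class P S qstar)) \<le> \<lceil>real (card S) / 2\<rceil>) \<and>
         (int (card (color_class P S qstar)) \<le> \<lceil>real (card S) / 2\<rceil> \<longleftrightarrow>
            color_discrepancy P S \<le> 1)"
proof -
  have "finite (item_copies P)" by (simp add: item_copies_def items_def)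
  then have fin: "finite S" using assms(2) finite_subset by blast
  have col: "copy_color P ` S \<subseteq> colors P"
    using assms(1,2) by (force simp: cbpp_instance_def item_copies_def copy_color_def)
  \<comment> \<open>For an integer \<open>k\<close>, being at most the ceiling of
    \<open>n / 2\<close> means \<open>k - 1 < n / 2\<close>, that is
    \<open>2 * k < n + 2\<close>.\<close>
  have half: "int (card (color_class P S qstar)) \<le> \<lceil>real (card S) / 2\<rceil> \<longleftrightarrow>
      2 * card (color_class P S qstar) \<le> card S + 1"
    unfolding le_ceiling_iff by (simp add: field_simps) linarith
  have disc: "color_discrepancy P S \<le> 1 \<longleftrightarrow> 2 * card (color_class P S qstar) \<le> card S + 1"
    unfolding color_discrepancy_eq [OF assms(4)] discrepancy_of_color_eq [OF fin] by linarith
  have "\<exists>xs. color_alternating_permutation P S xs"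
    if "2 * card (color_class P S qstar) \<le> card S + 1"
  proof -
    have all: "2 * card {x \<in> S. copy_color P x = q} \<le> card S + 1" for q
      using card_color_class_le_critical [OF fin col assms(4), of q] that
      by (simp add: color_class_def)
    \<comment> \<open>\<open>0\<close> is not a color, so initially no color is forbidden.\<close>
    have "{x \<in> S. copy_color P x = 0} = {}" using col by (auto simp: colors_def)
    then have "2 * card {x \<in> S. copy_color P x = 0} \<le> card S" by (metis card.empty mult_0_right zero_le)
    from ex_alternating_permutation_avoiding [OF fin all this] show ?thesis
      by (auto simp: color_alternating_permutation_def)
  qed
  then show ?thesis
    using half disc card_color_class_alternating_le by blast
qed

end
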